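(* Let $K\subset\mathbb{R}^n$ be a nonempty closed convex set, let $P:\mathbb{R}^n\to\mathbb{R}^n$ be a polynomial map of degree $d$, where $d$ is a positive integer, and let $\mathcal{S}:=\mathrm{SOL}(K^\infty,P^\infty)$. Assume that $0\in K$ and $P$ is copositive on $K$. If $p\in\mathrm{int}(\mathcal{S}^* )$, then $\mathrm{SOL}(K,P+p)$ is nonempty and bounded.
   Context: For a nonempty closed convex set $K\subset\mathbb{R}^n$ and a continuous map $F:\mathbb{R}^n\to\mathbb{R}^n$, $\mathrm{SOL}(K,F)$ denotes the set of $x\in K$ such that $\langle F(x),y-x\rangle\ge 0$ for all $y\in K$. For $p\in\mathbb{R}^n$, $P+p$ denotes the map $x\mapsto P(x)+p$. The asymptotic cone of $K$ is $K^\infty=\{v\in\mathbb{R}^n:\exists t_k\to\infty,\ \exists x_k\in K,\ x_k/t_k\to v\}$ (the recession cone of $K$). For a polynomial map $P=(P_1,\dots,P_n)$, its degree is $d=\max_l\deg P_l$, and $P^\infty=(P_1^\infty,\dots,P_n^\infty)$, where $P_l^\infty$ is the homogeneous component of degree $d$ of $P_l$. A map $F$ is copositive on $K$ if $\langle F(x),x\rangle\ge 0$ for all $x\in K$. For a cone $C\subset\mathbb{R}^n$ (not necessarily convex), $C^*=\{q\in\mathbb{R}^n:\langle q,v\rangle\ge 0\ \forall v\in C\}$ is its dual cone and $\mathrm{int}$ denotes interior. *)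

theory Defs
  imports "HOL-Analysis.Analysis" "HOL-Library.Poly_Mapping"
begin

text \<open>
  Real polynomials in the variables \<open>x $ i\<close>, \<open>i :: 'n\<close>, are finitely supported maps from
  exponent vectors to coefficients; the library's ring structure on this type is the polynomial
  ring.  A polynomial map is a vector of such polynomials.
\<close>

type_synonym 'n monom = "'n \<Rightarrow>\<^sub>0 nat"
type_synonym 'n mpoly = "'n monom \<Rightarrow>\<^sub>0 real"
type_synonym 'n poly_map = "('n mpoly, 'n) vec"

definition monom_degree :: "'n::finite monom \<Rightarrow> nat" where
  "monom_degree m = (\<Sum>i\<in>UNIV. Poly_Mapping.lookup m i)"

definition mpoly_eval :: "'n::finite mpoly \<Rightarrow> real ^ 'n \<Rightarrow> real" where
  "mpoly_eval p x =
     (\<Sum>m\<in>Poly_Mapping.keys p.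
        Poly_Mapping.lookup p m * (\<Prod>i\<in>UNIV. (x $ i) ^ Poly_Mapping.lookup m i))"

text \<open>The zero polynomial gets degree 0.\<close>

definition mpoly_degree :: "'n::finite mpoly \<Rightarrow> nat" where
  "mpoly_degree p = Max (insert 0 (monom_degree ` Poly_Mapping.keys p))"

definition mpoly_hom_component :: "nat \<Rightarrow> 'n::finite mpoly \<Rightarrow> 'n mpoly" where
  "mpoly_hom_component d p =
     (\<Sum>m\<in>{m \<in> Poly_Mapping.keys p. monom_degree m = d}.
        Poly_Mapping.single m (Poly_Mapping.lookup p m))"

definition poly_map_eval :: "'n::finite poly_map \<Rightarrow> real ^ 'n \<Rightarrow> real ^ 'n" where
  "poly_map_eval P x = (\<chi> l. mpoly_eval (P $ l) x)"

definition poly_map_degree :: "'n::finite poly_map \<Rightarrow> nat" where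
  "poly_map_degree P = (MAX l. mpoly_degree (P $ l))"

text \<open>
  Every component is cut at the degree of the whole map, so a component of smaller degree
  contributes 0.
\<close>

definition poly_map_infinity :: "'n::finite poly_map \<Rightarrow> 'n poly_map" where
  "poly_map_infinity P = (\<chi> l. mpoly_hom_component (poly_map_degree P) (P $ l))"

definition SOL :: "(real ^ 'n::finite) set \<Rightarrow> (real ^ 'n \<Rightarrow> real ^ 'n) \<Rightarrow> (real ^ 'n) set" where
  "SOL K F = {x \<in> K. \<forall>y\<in>K. F x \<bullet> (y - x) \<ge> 0}"

definition asymptotic_cone :: "(real ^ 'n::finite) set \<Rightarrow> (real ^ 'n) set" where
  "asymptotic_cone K =
     {v. \<exists>(t :: nat \<Rightarrow> real) x. filterlim t at_top sequentially \<and> (\<forall>k. x k \<in> K) \<and>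
           (\<lambda>k. x k /\<^sub>R t k) \<longlonglongrightarrow> v}"

definition copositive_on :: "(real ^ 'n::finite) set \<Rightarrow> (real ^ 'n \<Rightarrow> real ^ 'n) \<Rightarrow> bool" where
  "copositive_on K F \<longleftrightarrow> (\<forall>x\<in>K. F x \<bullet> x \<ge> 0)"

definition dual_cone :: "(real ^ 'n::finite) set \<Rightarrow> (real ^ 'n) set" where
  "dual_cone C = {q. \<forall>v\<in>C. q \<bullet> v \<ge> 0}"

end

theory Submission
  imports Defs
begin

text \<open>
  Say that \<open>x \<in> K\<close> solves the problem truncated at its own norm if the variational inequality at
  \<open>x\<close> holds against all \<open>y \<in> K\<close> with \<open>\<parallel>y\<parallel> \<le> \<parallel>x\<parallel>\<close>.  Every solution over \<open>K\<close> has this property, and so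
  does every solution over a ball-shaped piece \<open>K \<inter> cball 0 r\<close>.  The heart of the matter is that
  such points are uniformly bounded (\<open>bounded_truncated_solutions\<close>).

  Otherwise there are such \<open>x\<^sub>k\<close> with \<open>\<parallel>x\<^sub>k\<parallel> \<rightarrow> \<infinity>\<close> and \<open>x\<^sub>k / \<parallel>x\<^sub>k\<parallel> \<rightarrow> v\<close>, where \<open>v\<close> is a unit vector of the
  asymptotic cone.  After division by \<open>\<parallel>x\<^sub>k\<parallel>\<^sup>d\<close> only the leading part of \<open>P\<close> survives in the limit.
  Testing with \<open>\<parallel>x\<^sub>k\<parallel> z\<close>, for \<open>z\<close> in the asymptotic cone and \<open>\<parallel>z\<parallel> \<le> 1\<close>, gives
  \<open>P\<^sup>\<infinity>(v) \<bullet> (z - v) \<ge> 0\<close>.  Copositivity gives \<open>P\<^sup>\<infinity>(v) \<bullet> v \<ge> 0\<close>, while \<open>z = 0\<close> gives the opposite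
  inequality; so \<open>P\<^sup>\<infinity>(v) \<bullet> v = 0\<close>, the bound on \<open>\<parallel>z\<parallel>\<close> can be scaled away, and \<open>v\<close> lies in the solution
  set \<open>S\<close> at infinity.  On the other hand, testing with \<open>0\<close> before passing to the limit and using
  copositivity again gives \<open>p \<bullet> x\<^sub>k \<le> 0\<close>, hence \<open>p \<bullet> v \<le> 0\<close>, which is impossible for \<open>p\<close> in the interior of
  the dual cone of \<open>S\<close>.

  Existence now follows from the Hartman--Stampacchia theorem on \<open>K \<inter> cball 0 r\<close> with \<open>r\<close> above the
  uniform bound: the solution it provides has norm less than \<open>r\<close>, so the truncation is not felt
  locally and, by convexity, not at all.
\<close>

section \<open>Leading behaviour of polynomial maps\<close>

definition monom_eval :: "'n::finite monom \<Rightarrow> real ^ 'n \<Rightarrow> real" where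
  "monom_eval m x = (\<Prod>i\<in>UNIV. (x $ i) ^ Poly_Mapping.lookup m i)"

lemma mpoly_eval_eq_sum_monom_eval:
  "mpoly_eval q x = (\<Sum>m\<in>Poly_Mapping.keys q. Poly_Mapping.lookup q m * monom_eval m x)"
  by (simp add: mpoly_eval_def monom_eval_def)

lemma monom_eval_scaleR: "monom_eval m (t *\<^sub>R x) = t ^ monom_degree m * monom_eval m x"
  by (simp add: monom_eval_def monom_degree_def power_mult_distrib prod.distrib power_sum)

lemma continuous_on_monom_eval: "continuous_on A (monom_eval m)"
  unfolding monom_eval_def by (intro continuous_intros)

lemma continuous_on_poly_map_eval: "continuous_on A (poly_map_eval P)"
  unfolding poly_map_eval_def mpoly_eval_eq_sum_monom_eval
  by (intro continuous_on_vec_lambda continuous_intros continuous_on_monom_eval)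

lemma lookup_mpoly_hom_component:
  "Poly_Mapping.lookup (mpoly_hom_component d q) m =
     (if monom_degree m = d then Poly_Mapping.lookup q m else 0)"
proof -
  have "Poly_Mapping.lookup (mpoly_hom_component d q) m =
      (\<Sum>m'\<in>{m' \<in> Poly_Mapping.keys q. monom_degree m' = d}.
         if m' = m then Poly_Mapping.lookup q m' else 0)"
    by (simp add: mpoly_hom_component_def lookup_sum lookup_single when_def)
  also have "\<dots> = (if monom_degree m = d then Poly_Mapping.lookup q m else 0)"
    by (auto simp: sum.delta in_keys_iff)
  finally show ?thesis .
qed

lemma mpoly_eval_hom_component:
  "mpoly_eval (mpoly_hom_component d q) x =
     (\<Sum>m\<in>Poly_Mapping.keys q.
        if monom_degree m = d then Poly_Mapping.lookup q m * monom_eval m x else 0)"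
proof -
  have "mpoly_eval (mpoly_hom_component d q) x =
      (\<Sum>m\<in>Poly_Mapping.keys q.
         Poly_Mapping.lookup (mpoly_hom_component d q) m * monom_eval m x)"
    unfolding mpoly_eval_eq_sum_monom_eval
    by (rule sum.mono_neutral_left)
       (auto simp: in_keys_iff lookup_mpoly_hom_component split: if_splits)
  also have "\<dots> = (\<Sum>m\<in>Poly_Mapping.keys q.
        if monom_degree m = d then Poly_Mapping.lookup q m * monom_eval m x else 0)"
    by (intro sum.cong) (auto simp: lookup_mpoly_hom_component)
  finally show ?thesis .
qed

lemma monom_degree_le_mpoly_degree:
  "m \<in> Poly_Mapping.keys q \<Longrightarrow> monom_degree m \<le> mpoly_degree q"
  by (simp add: mpoly_degree_def)

lemma mpoly_degree_le_poly_map_degree: "mpoly_degree (P $ l) \<le> poly_map_degree P"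
  by (simp add: poly_map_degree_def)

text \<open>
  A monomial of degree \<open>e\<close> scales by \<open>t\<^sup>e\<close>, so division by \<open>t\<^sup>d\<close> kills every degree below \<open>d\<close> and keeps
  degree \<open>d\<close> unchanged.
\<close>

lemma tendsto_mpoly_eval_leading:
  fixes t :: "nat \<Rightarrow> real" and u :: "nat \<Rightarrow> real ^ 'n::finite"
  assumes t: "filterlim t at_top sequentially" and u: "u \<longlonglongrightarrow> v"
    and deg: "mpoly_degree q \<le> d"
  shows "(\<lambda>k. mpoly_eval q (t k *\<^sub>R u k) / t k ^ d) \<longlonglongrightarrow> mpoly_eval (mpoly_hom_component d q) v"
proof -
  have "(\<lambda>k. Poly_Mapping.lookup q m * monom_eval m (t k *\<^sub>R u k) / t k ^ d) \<longlonglongrightarrow>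
      (if monom_degree m = d then Poly_Mapping.lookup q m * monom_eval m v else 0)"
    if m: "m \<in> Poly_Mapping.keys q" for m
  proof -
    let ?e = "monom_degree m"
    have le: "?e \<le> d"
      using monom_degree_le_mpoly_degree[OF m] deg by simp
    have "isCont (monom_eval m) v"
      using continuous_on_monom_eval[of UNIV m] by (simp add: continuous_on_eq_continuous_at)
    then have lim_u: "(\<lambda>k. monom_eval m (u k)) \<longlonglongrightarrow> monom_eval m v"
      using u by (rule isCont_tendsto_compose)
    have lim_t: "(\<lambda>k. inverse (t k) ^ (d - ?e)) \<longlonglongrightarrow> (if ?e = d then 1 else 0)"
    proof (cases "?e = d")
      case False
      have "(\<lambda>k. inverse (t k) ^ (d - ?e)) \<longlonglongrightarrow> 0 ^ (d - ?e)"
        using t by (intro tendsto_power tendsto_inverse_0_at_top)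
      moreover have "(0::real) ^ (d - ?e) = 0"
        using False le by simp
      ultimately show ?thesis
        using False by (simp only: if_False)
    qed simp
    have "(\<lambda>k. Poly_Mapping.lookup q m * (inverse (t k) ^ (d - ?e) * monom_eval m (u k))) \<longlonglongrightarrow>
        Poly_Mapping.lookup q m * ((if ?e = d then 1 else 0) * monom_eval m v)"
      by (intro tendsto_mult tendsto_const lim_t lim_u)
    moreover have "\<forall>\<^sub>F k in sequentially.
        Poly_Mapping.lookup q m * (inverse (t k) ^ (d - ?e) * monom_eval m (u k)) =
        Poly_Mapping.lookup q m * monom_eval m (t k *\<^sub>R u k) / t k ^ d"
      using filterlim_at_top_dense[THEN iffD1, OF t, rule_format, of 0]
    proof eventually_elim
      case (elim k)
      have "t k ^ d = t k ^ ?e * t k ^ (d - ?e)"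
        using le by (simp flip: power_add)
      then show ?case
        using elim by (simp add: monom_eval_scaleR field_simps)
    qed
    ultimately show ?thesis
      by (auto elim: Lim_transform_eventually split: if_splits)
  qed
  then show ?thesis
    unfolding mpoly_eval_hom_component
    by (auto simp: mpoly_eval_eq_sum_monom_eval sum_divide_distrib intro!: tendsto_sum)
qed

lemma tendsto_poly_map_eval_leading:
  fixes t :: "nat \<Rightarrow> real"
  assumes "filterlim t at_top sequentially" and "u \<longlonglongrightarrow> v"
  shows "(\<lambda>k. poly_map_eval P (t k *\<^sub>R u k) /\<^sub>R t k ^ poly_map_degree P) \<longlonglongrightarrow>
           poly_map_eval (poly_map_infinity P) v"
proof (rule vec_tendstoI)
  fix l
  show "(\<lambda>k. (poly_map_eval P (t k *\<^sub>R u k) /\<^sub>R t k ^ poly_map_degree P) $ l) \<longlonglongrightarrow>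
      poly_map_eval (poly_map_infinity P) v $ l"
    using tendsto_mpoly_eval_leading[OF assms mpoly_degree_le_poly_map_degree[of P l]]
    by (simp add: poly_map_eval_def poly_map_infinity_def divide_inverse mult.commute)
qed

section \<open>Asymptotic and dual cones\<close>

text \<open>
  Here \<open>s v\<close> is the limit of the points \<open>(s / t\<^sub>k) x\<^sub>k\<close>, which lie on the segments from \<open>0\<close> to
  \<open>x\<^sub>k\<close> once \<open>t\<^sub>k \<ge> s\<close>.
\<close>

lemma scaleR_asymptotic_cone_in_closed_convex:
  assumes "closed K" and "convex K" and "0 \<in> K" and "v \<in> asymptotic_cone K" and "s \<ge> 0"
  shows "s *\<^sub>R v \<in> K"
proof -
  obtain t x where t: "filterlim t at_top sequentially" and x: "\<And>k. x k \<in> K"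
    and lim: "(\<lambda>k. x k /\<^sub>R t k) \<longlonglongrightarrow> v"
    using assms(4) unfolding asymptotic_cone_def by blast
  have "\<forall>\<^sub>F k in sequentially. s *\<^sub>R (x k /\<^sub>R t k) \<in> K"
    using filterlim_at_top_dense[THEN iffD1, OF t, rule_format, of s]
  proof eventually_elim
    case (elim k)
    have "(1 - s / t k) *\<^sub>R 0 + (s / t k) *\<^sub>R x k \<in> K"
      using elim assms(5) by (intro convexD[OF \<open>convex K\<close> \<open>0 \<in> K\<close> x]) auto
    then show ?case
      by (simp add: divide_inverse)
  qed
  then show ?thesis
    by (rule Lim_in_closed_set[OF \<open>closed K\<close> _ _ tendsto_scaleR[OF tendsto_const lim]]) simp
qed

text \<open>
  Moving \<open>p\<close> slightly in the direction \<open>- v\<close> stays in the dual cone and lowers the product with \<open>v\<close> by a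
  positive multiple of \<open>\<parallel>v\<parallel>\<^sup>2\<close>.
\<close>

lemma inner_pos_if_interior_dual_cone:
  assumes "p \<in> interior (dual_cone C)" and "v \<in> C" and "v \<noteq> 0"
  shows "p \<bullet> v > 0"
proof -
  obtain e where "e > 0" and e: "cball p e \<subseteq> dual_cone C"
    using assms(1) by (auto simp: mem_interior_cball)
  have "p - (e / norm v) *\<^sub>R v \<in> dual_cone C"
    using e \<open>e > 0\<close> assms(3) by (intro subsetD[OF e]) (simp add: dist_norm)
  then have "p \<bullet> v \<ge> (e / norm v) * (v \<bullet> v)"
    using assms(2) by (auto simp: dual_cone_def inner_diff_left)
  moreover have "(e / norm v) * (v \<bullet> v) > 0"
    using \<open>e > 0\<close> assms(3) by simp
  ultimately show ?thesis
    by linarith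
qed

section \<open>Variational inequalities over truncated sets\<close>

text \<open>
  The Hartman--Stampacchia theorem.  By Brouwer, \<open>x \<mapsto> proj\<^sub>C (x - F x)\<close> has a fixed point in \<open>C\<close>, and the
  obtuse-angle characterisation of the projection turns the fixed-point equation into the variational
  inequality.
\<close>

lemma SOL_compact_convex_nonempty:
  assumes "compact C" and "convex C" and "C \<noteq> {}" and "continuous_on C F"
  shows "SOL C F \<noteq> {}"
proof -
  have "closed C"
    using assms(1) by (rule compact_imp_closed)
  have "continuous_on C (\<lambda>x. closest_point C (x - F x))"
    by (rule continuous_on_compose2[OF continuous_on_closest_point[OF assms(2) \<open>closed C\<close> assms(3)]])
       (intro continuous_on_diff continuous_on_id assms(4), rule subset_UNIV)
  then obtain x where "x \<in> C" and fixed: "closest_point C (x - F x) = x"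
    using brouwer[OF assms(1-3), of "\<lambda>x. closest_point C (x - F x)"]
      closest_point_in_set[OF \<open>closed C\<close> assms(3)] by blast
  have "F x \<bullet> (y - x) \<ge> 0" if "y \<in> C" for y
    using closest_point_dot[OF assms(2) \<open>closed C\<close> that, of "x - F x"] by (simp add: fixed)
  then show ?thesis
    using \<open>x \<in> C\<close> by (auto simp: SOL_def)
qed

text \<open>
  A short enough initial piece of the segment from \<open>x\<close> to any \<open>y \<in> K\<close> stays in the ball, and the
  variational inequality depends only on the direction \<open>y - x\<close>.
\<close>

lemma SOL_truncated_imp_SOL:
  assumes "convex K" and "x \<in> SOL (K \<inter> cball 0 r) F" and "norm x < r"
  shows "x \<in> SOL K F"
proof -
  have "x \<in> K"
    using assms(2) by (simp add: SOL_def)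
  have "F x \<bullet> (y - x) \<ge> 0" if "y \<in> K" for y
  proof -
    define s where "s = min 1 ((r - norm x) / (norm (y - x) + 1))"
    have s: "0 < s" "s \<le> 1" "s \<le> (r - norm x) / (norm (y - x) + 1)"
      using assms(3) by (auto simp: s_def add_nonneg_pos)
    have "s * norm (y - x) \<le> s * (norm (y - x) + 1)"
      using s(1) by simp
    also have "\<dots> \<le> r - norm x"
      using s(3) by (simp add: pos_le_divide_eq add_nonneg_pos)
    finally have "norm (x + s *\<^sub>R (y - x)) \<le> r"
      using norm_triangle_ineq[of x "s *\<^sub>R (y - x)"] s(1) by simp
    moreover have "x + s *\<^sub>R (y - x) \<in> K"
      using convexD_alt[OF assms(1) \<open>x \<in> K\<close> that, of s] s by (simp add: algebra_simps)
    ultimately have "x + s *\<^sub>R (y - x) \<in> K \<inter> cball 0 r"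
      by simp
    then have "F x \<bullet> (x + s *\<^sub>R (y - x) - x) \<ge> 0"
      using assms(2) unfolding SOL_def by blast
    then show ?thesis
      using s(1) by (simp add: zero_le_mult_iff)
  qed
  then show ?thesis
    using \<open>x \<in> K\<close> by (simp add: SOL_def)
qed

section \<open>The uniform bound\<close>

text \<open>
  Directions at infinity of truncated solutions solve the problem at infinity.  The norm bound on
  the test points makes this apply to solutions over balls as well as to solutions over \<open>K\<close>;
  copositivity compensates for it by forcing \<open>P\<^sup>\<infinity>(v) \<bullet> v = 0\<close>.  The degree has to be positive for
  the perturbation \<open>p\<close> to vanish in the limit.
\<close>

lemma asymptotic_direction_in_SOL_infinity:
  fixes K :: "(real ^ 'n::finite) set" and x :: "nat \<Rightarrow> real ^ 'n"
  assumes "closed K" and "convex K" and "0 \<in> K"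
    and deg: "poly_map_degree P > 0"
    and cop: "copositive_on K (poly_map_eval P)"
    and xK: "\<And>k. x k \<in> K"
    and VI: "\<And>k y. \<lbrakk>y \<in> K; norm y \<le> norm (x k)\<rbrakk> \<Longrightarrow> (poly_map_eval P (x k) + p) \<bullet> (y - x k) \<ge> 0"
    and inf: "filterlim (\<lambda>k. norm (x k)) at_top sequentially"
    and lim: "(\<lambda>k. x k /\<^sub>R norm (x k)) \<longlonglongrightarrow> v"
  shows "v \<in> SOL (asymptotic_cone K) (poly_map_eval (poly_map_infinity P))"
proof -
  define d where "d = poly_map_degree P"
  define Q where "Q = poly_map_eval (poly_map_infinity P) v"
  define t where "t k = norm (x k)" for k
  define u where "u k = x k /\<^sub>R t k" for k
  have t_top: "filterlim t at_top sequentially"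
    using inf by (simp add: t_def[abs_def])
  have u_lim: "u \<longlonglongrightarrow> v"
    using lim by (simp add: t_def u_def[abs_def])
  have t_pos: "\<forall>\<^sub>F k in sequentially. t k > 0"
    using t_top by (auto simp: filterlim_at_top_dense)
  have x_eq: "x k = t k *\<^sub>R u k" for k
    by (cases "x k = 0") (auto simp: t_def u_def)
  have P_lim: "(\<lambda>k. poly_map_eval P (x k) /\<^sub>R t k ^ d) \<longlonglongrightarrow> Q"
    unfolding x_eq d_def Q_def by (rule tendsto_poly_map_eval_leading[OF t_top u_lim])
  have "(\<lambda>k. inverse (t k) ^ d) \<longlonglongrightarrow> 0 ^ d"
    by (intro tendsto_power tendsto_inverse_0_at_top t_top)
  moreover have "(0::real) ^ d = 0"
    using deg by (simp add: d_def)
  ultimately have "(\<lambda>k. inverse (t k) ^ d *\<^sub>R p) \<longlonglongrightarrow> 0 *\<^sub>R p"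
    by (intro tendsto_scaleR tendsto_const) (simp only:)
  then have Pp_lim: "(\<lambda>k. (poly_map_eval P (x k) + p) /\<^sub>R t k ^ d) \<longlonglongrightarrow> Q"
    using tendsto_add[OF P_lim, of "\<lambda>k. inverse (t k) ^ d *\<^sub>R p" 0]
    by (simp add: scaleR_add_right power_inverse)
  have test: "Q \<bullet> (z - v) \<ge> 0" if z: "z \<in> asymptotic_cone K" "norm z \<le> 1" for z
  proof (rule tendsto_lowerbound)
    show "(\<lambda>k. ((poly_map_eval P (x k) + p) /\<^sub>R t k ^ d) \<bullet> (z - u k)) \<longlonglongrightarrow> Q \<bullet> (z - v)"
      by (intro tendsto_inner Pp_lim tendsto_diff tendsto_const u_lim)
    show "\<forall>\<^sub>F k in sequentially. ((poly_map_eval P (x k) + p) /\<^sub>R t k ^ d) \<bullet> (z - u k) \<ge> 0"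
      using t_pos
    proof eventually_elim
      case (elim k)
      have "t k *\<^sub>R z \<in> K"
        using elim by (intro scaleR_asymptotic_cone_in_closed_convex assms z) auto
      moreover have "norm (t k *\<^sub>R z) \<le> norm (x k)"
        using z(2) by (simp add: t_def mult_left_le)
      ultimately have "(poly_map_eval P (x k) + p) \<bullet> (t k *\<^sub>R z - x k) \<ge> 0"
        by (rule VI)
      moreover have "t k *\<^sub>R z - x k = t k *\<^sub>R (z - u k)"
        by (subst x_eq) (simp add: scaleR_diff_right)
      ultimately have "t k * ((poly_map_eval P (x k) + p) \<bullet> (z - u k)) \<ge> 0"
        by simp
      then show ?case
        using elim by (simp add: zero_le_mult_iff)
    qed
  qed simp
  have v_cone: "v \<in> asymptotic_cone K"
    unfolding asymptotic_cone_def using inf xK lim by blast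
  have zero_cone: "0 \<in> asymptotic_cone K"
    unfolding asymptotic_cone_def mem_Collect_eq
    by (rule exI[of _ "\<lambda>k. norm (x k)"], rule exI[of _ "\<lambda>k. 0"])
       (use inf \<open>0 \<in> K\<close> in auto)
  have "Q \<bullet> v \<ge> 0"
  proof (rule tendsto_lowerbound)
    show "(\<lambda>k. (poly_map_eval P (x k) /\<^sub>R t k ^ d) \<bullet> u k) \<longlonglongrightarrow> Q \<bullet> v"
      by (intro tendsto_inner P_lim u_lim)
    show "\<forall>\<^sub>F k in sequentially. (poly_map_eval P (x k) /\<^sub>R t k ^ d) \<bullet> u k \<ge> 0"
      using cop xK by (auto simp: copositive_on_def u_def t_def)
  qed simp
  moreover have "Q \<bullet> v \<le> 0"
    using test[OF zero_cone] by simp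
  ultimately have Qv: "Q \<bullet> v = 0"
    by simp
  have "Q \<bullet> (y - v) \<ge> 0" if y: "y \<in> asymptotic_cone K" for y
  proof -
    \<comment> \<open>Shrink \<open>y\<close> into the unit ball; the cone property is read off from the defining sequence.\<close>
    define c where "c = inverse (norm y + 1)"
    have c: "c > 0" "c * norm y \<le> 1"
      using add_nonneg_pos[OF norm_ge_zero[of y] zero_less_one] by (auto simp: c_def field_simps)
    obtain s w where s: "filterlim s at_top sequentially" and w: "\<And>k::nat. w k \<in> K"
      and y_lim: "(\<lambda>k. w k /\<^sub>R s k) \<longlonglongrightarrow> y"
      using y unfolding asymptotic_cone_def by blast
    have "filterlim (\<lambda>k. inverse c * s k) at_top sequentially"
      using c(1) s by (intro filterlim_tendsto_pos_mult_at_top[OF tendsto_const]) auto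
    moreover have "(\<lambda>k. w k /\<^sub>R (inverse c * s k)) \<longlonglongrightarrow> c *\<^sub>R y"
      using tendsto_scaleR[OF tendsto_const[of c] y_lim] by simp
    ultimately have "c *\<^sub>R y \<in> asymptotic_cone K"
      unfolding asymptotic_cone_def using w by blast
    then have "Q \<bullet> (c *\<^sub>R y - v) \<ge> 0"
      using c by (intro test) auto
    then show ?thesis
      using c(1) Qv by (simp add: inner_diff_right zero_le_mult_iff)
  qed
  then show ?thesis
    using v_cone by (simp add: SOL_def Q_def)
qed

text \<open>
  The two effects of an unbounded sequence collide: its limit direction \<open>v\<close> belongs to the solution set
  at infinity, so \<open>p \<bullet> v > 0\<close>, whereas the test point \<open>0\<close> and copositivity give \<open>p \<bullet> x\<^sub>k \<le> 0\<close> for all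
  members of the sequence.
\<close>

lemma bounded_truncated_solutions:
  fixes K :: "(real ^ 'n::finite) set"
  assumes "closed K" and "convex K" and "0 \<in> K"
    and "poly_map_degree P > 0"
    and cop: "copositive_on K (poly_map_eval P)"
    and p: "p \<in> interior (dual_cone (SOL (asymptotic_cone K) (poly_map_eval (poly_map_infinity P))))"
  shows "bounded {x \<in> K. \<forall>y\<in>K. norm y \<le> norm x \<longrightarrow> (poly_map_eval P x + p) \<bullet> (y - x) \<ge> 0}"
    (is "bounded ?T")
proof (rule ccontr)
  assume "\<not> bounded ?T"
  have "\<exists>x. x \<in> ?T \<and> norm x > real k" for k :: nat
  proof (rule ccontr)
    assume "\<nexists>x. x \<in> ?T \<and> norm x > real k"
    then have "bounded ?T"
      by (intro boundedI[of _ "real k"]) (use linorder_not_le in blast)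
    with \<open>\<not> bounded ?T\<close> show False ..
  qed
  then have "\<exists>x. \<forall>k. x k \<in> ?T \<and> norm (x k) > real k"
    by (rule choice[OF allI])
  then obtain x where xT: "\<And>k. x k \<in> ?T" and x_big: "\<And>k. norm (x k) > real k"
    by blast
  have x_top: "filterlim (\<lambda>k. norm (x k)) at_top sequentially"
    by (rule filterlim_at_top_mono[OF filterlim_real_sequentially])
       (simp add: less_imp_le[OF x_big])
  have "x k \<noteq> 0" for k
    using x_big[of k] by auto
  then have "\<forall>k. x k /\<^sub>R norm (x k) \<in> sphere 0 1"
    by simp
  then obtain v r where v: "v \<in> sphere 0 1" and r: "strict_mono r"
    and lim: "((\<lambda>k. x k /\<^sub>R norm (x k)) \<circ> r) \<longlonglongrightarrow> v"
    by (rule seq_compactE[OF compact_imp_seq_compact[OF compact_sphere]])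
  have lim': "(\<lambda>k. x (r k) /\<^sub>R norm (x (r k))) \<longlonglongrightarrow> v"
    using lim by (simp add: comp_def)
  have "v \<in> SOL (asymptotic_cone K) (poly_map_eval (poly_map_infinity P))"
  proof (rule asymptotic_direction_in_SOL_infinity[OF assms(1-5) _ _ _ lim'])
    show "filterlim (\<lambda>k. norm (x (r k))) at_top sequentially"
      by (rule filterlim_compose[OF x_top filterlim_subseq[OF r]])
  qed (use xT in auto)
  then have "p \<bullet> v > 0"
    using v by (intro inner_pos_if_interior_dual_cone[OF p]) auto
  moreover have "p \<bullet> v \<le> 0"
  proof (rule tendsto_upperbound)
    show "(\<lambda>k. p \<bullet> (x (r k) /\<^sub>R norm (x (r k)))) \<longlonglongrightarrow> p \<bullet> v"
      by (intro tendsto_inner tendsto_const lim')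
    have "p \<bullet> x k \<le> 0" for k
    proof -
      have "(poly_map_eval P (x k) + p) \<bullet> (0 - x k) \<ge> 0" and "poly_map_eval P (x k) \<bullet> x k \<ge> 0"
        using xT[of k] \<open>0 \<in> K\<close> cop by (auto simp: copositive_on_def)
      then show ?thesis
        by (simp add: inner_add_left)
    qed
    then show "\<forall>\<^sub>F k in sequentially. p \<bullet> (x (r k) /\<^sub>R norm (x (r k))) \<le> 0"
      by (simp add: mult_nonneg_nonpos)
  qed simp
  ultimately show False
    by simp
qed

section \<open>Existence and boundedness of solutions\<close>

theorem theorem4p1:
  fixes K :: "(real ^ 'n::finite) set"
    and P :: "'n poly_map"
    and d :: nat
    and S :: "(real ^ 'n) set"
    and p :: "real ^ 'n"
  assumes "K \<noteq> {}" and "closed K" and "convex K"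
    and "poly_map_degree P = d" and "d > 0"
    and "S = SOL (asymptotic_cone K) (poly_map_eval (poly_map_infinity P))"
    and "0 \<in> K"
    and "copositive_on K (poly_map_eval P)"
    and "p \<in> interior (dual_cone S)"
  shows "SOL K (\<lambda>x. poly_map_eval P x + p) \<noteq> {} \<and> bounded (SOL K (\<lambda>x. poly_map_eval P x + p))"
proof
  let ?F = "\<lambda>x. poly_map_eval P x + p"
  let ?T = "{x \<in> K. \<forall>y\<in>K. norm y \<le> norm x \<longrightarrow> ?F x \<bullet> (y - x) \<ge> 0}"
  have T: "bounded ?T"
    using assms by (intro bounded_truncated_solutions) auto
  show "bounded (SOL K ?F)"
    by (rule bounded_subset[OF T]) (auto simp: SOL_def)
  obtain R where R: "R > 0" "\<And>x. x \<in> ?T \<Longrightarrow> norm x \<le> R"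
    using T unfolding bounded_pos by blast
  let ?C = "K \<inter> cball 0 (R + 1)"
  have "compact ?C" and "convex ?C" and "?C \<noteq> {}"
    using assms R(1) by (auto intro: closed_Int_compact convex_Int)
  moreover have "continuous_on ?C ?F"
    by (intro continuous_intros continuous_on_poly_map_eval)
  ultimately obtain x where x: "x \<in> SOL ?C ?F"
    using SOL_compact_convex_nonempty by blast
  then have "x \<in> ?T"
    by (auto simp: SOL_def)
  then have "norm x < R + 1"
    using R(2) by fastforce
  then show "SOL K ?F \<noteq> {}"
    using SOL_truncated_imp_SOL[OF \<open>convex K\<close> x] by blast
qed

end
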